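(* Let $Q$ be a commutative A-loop and define $x\oplus y = \big( ((xy)\backslash x)\cdot((yx)\backslash y)\big)^{-1}$. Then for all $x,y\in Q$, $x^2y^2 = (x\oplus y)^2$.
   Context: A loop is a set with a binary operation and neutral element $1$ in which all left and right translations $L_x:y\mapsto xy$, $R_x:y\mapsto yx$ are bijections; $\mathrm{Inn}(Q)$ is the stabilizer of $1$ in the group generated by all translations. A commutative A-loop is a commutative loop all of whose inner mappings are automorphisms. $x\backslash y$ denotes the unique $z$ with $xz=y$, $x^{-1}=x\backslash 1$, and $x^2=xx$. *)

theory Defs
  imports Main
begin

definition loop :: "('a \<Rightarrow> 'a \<Rightarrow> 'a) \<Rightarrow> 'a \<Rightarrow> bool" where
  "loop m e \<longleftrightarrow> (\<forall>x. m e x = x \<and> m x e = x) \<and> (\<forall>x. bij (m x)) \<and> (\<forall>x. bij (\<lambda>y. m y x))"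

inductive_set mlt_group :: "('a \<Rightarrow> 'a \<Rightarrow> 'a) \<Rightarrow> ('a \<Rightarrow> 'a) set" for m where
  mlt_id: "id \<in> mlt_group m"
| mlt_L: "f \<in> mlt_group m \<Longrightarrow> m x \<circ> f \<in> mlt_group m"
| mlt_Linv: "f \<in> mlt_group m \<Longrightarrow> inv (m x) \<circ> f \<in> mlt_group m"
| mlt_R: "f \<in> mlt_group m \<Longrightarrow> (\<lambda>y. m y x) \<circ> f \<in> mlt_group m"
| mlt_Rinv: "f \<in> mlt_group m \<Longrightarrow> inv (\<lambda>y. m y x) \<circ> f \<in> mlt_group m"

definition inn :: "('a \<Rightarrow> 'a \<Rightarrow> 'a) \<Rightarrow> 'a \<Rightarrow> ('a \<Rightarrow> 'a) set" where
  "inn m e = {f \<in> mlt_group m. f e = e}"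

definition automorphism :: "('a \<Rightarrow> 'a \<Rightarrow> 'a) \<Rightarrow> ('a \<Rightarrow> 'a) \<Rightarrow> bool" where
  "automorphism m f \<longleftrightarrow> bij f \<and> (\<forall>x y. f (m x y) = m (f x) (f y))"

definition comm_A_loop :: "('a \<Rightarrow> 'a \<Rightarrow> 'a) \<Rightarrow> 'a \<Rightarrow> bool" where
  "comm_A_loop m e \<longleftrightarrow> loop m e \<and> (\<forall>x y. m x y = m y x) \<and> (\<forall>f \<in> inn m e. automorphism m f)"

definition ldiv :: "('a \<Rightarrow> 'a \<Rightarrow> 'a) \<Rightarrow> 'a \<Rightarrow> 'a \<Rightarrow> 'a" where
  "ldiv m x y = (THE z. m x z = y)"

definition linv :: "('a \<Rightarrow> 'a \<Rightarrow> 'a) \<Rightarrow> 'a \<Rightarrow> 'a \<Rightarrow> 'a" where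
  "linv m e x = ldiv m x e"

definition loop_oplus :: "('a \<Rightarrow> 'a \<Rightarrow> 'a) \<Rightarrow> 'a \<Rightarrow> 'a \<Rightarrow> 'a \<Rightarrow> 'a" where
  "loop_oplus m e x y = linv m e (m (ldiv m (m x y) x) (ldiv m (m y x) y))"

end

theory Submission
  imports Defs
begin

text \<open>
  Write \<open>L\<^sub>x\<close> for translations, \<open>x'\<close> for inverses, \<open>P\<^sub>x = L\<^sub>x L\<^sub>x\<^sub>'\<^sup>-\<^sup>1\<close>, \<open>z = xy\<close>, and let
  \<open>\<phi> = L\<^sub>z\<^sup>-\<^sup>1 L\<^sub>x L\<^sub>y\<close>, an automorphism fixing \<open>x\<close>. The automorphic inverse property \<open>(xy)' = x'y'\<close>
  shows that \<open>\<phi>\<close> is unchanged when \<open>x\<close> and \<open>y\<close> are replaced by their inverses. This yields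
  \<open>P\<^sub>x\<^sub>y = L\<^sub>x P\<^sub>y L\<^sub>x\<^sub>'\<^sup>-\<^sup>1\<close>, from which \<open>P\<^sub>u\<close> for \<open>u = P\<^sub>x y\<close> is \<open>P\<^sub>x P\<^sub>y P\<^sub>x\<close>, and
  \<open>\<phi>(P\<^sub>y x) = xy\<^sup>2\<close>. With \<open>s = x\<^sup>2(x\P\<^sub>y x)\<close> the latter gives \<open>\<phi>(s) = x\<^sup>2y\<^sup>2\<close>. On the other hand
  \<open>x \<oplus> y = a b\<close> with \<open>a = \<phi>(y)\<close> and \<open>b = L\<^sub>z\<^sup>-\<^sup>1 L\<^sub>y L\<^sub>x (x)\<close>, so
  \<open>(x \<oplus> y)\<^sup>2 = P\<^sub>a\<^sub>b 1 = a \<cdot> P\<^sub>b a\<close>, and unfolding both factors turns this into \<open>\<phi>(s)\<close> as well.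
\<close>

locale comm_automorphic_loop =
  fixes mult :: "'a \<Rightarrow> 'a \<Rightarrow> 'a" (infixl "\<cdot>" 70) and e :: 'a
  assumes comm_A_loop: "comm_A_loop mult e"
begin

abbreviation div_left :: "'a \<Rightarrow> 'a \<Rightarrow> 'a" (infixl "\<rightharpoondown>" 65) where
  "x \<rightharpoondown> y \<equiv> ldiv mult x y"

abbreviation inverse_elem :: "'a \<Rightarrow> 'a" ("_\<acute>" [1000] 1000) where
  "x\<acute> \<equiv> linv mult e x"

definition inner :: "'a \<Rightarrow> 'a \<Rightarrow> 'a \<Rightarrow> 'a" where
  "inner x y w = x \<cdot> y \<rightharpoondown> x \<cdot> (y \<cdot> w)"

definition P :: "'a \<Rightarrow> 'a \<Rightarrow> 'a" where
  "P x w = x\<acute> \<rightharpoondown> x \<cdot> w"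

lemma loop: "loop mult e"
  and mult_commute: "x \<cdot> y = y \<cdot> x"
  and inn_automorphism: "f \<in> inn mult e \<Longrightarrow> automorphism mult f"
  using comm_A_loop by (auto simp: comm_A_loop_def)

lemma mult_e [simp]: "e \<cdot> x = x" "x \<cdot> e = x"
  using loop by (auto simp: loop_def)

lemma bij_mult: "bij (mult x)"
  using loop by (auto simp: loop_def)

lemma mult_left_cancel [simp]: "x \<cdot> y = x \<cdot> z \<longleftrightarrow> y = z"
  using bij_mult[of x] by (auto simp: bij_def inj_def)

lemma ldiv_mult [simp]: "x \<rightharpoondown> x \<cdot> y = y"
  by (simp add: ldiv_def)

lemma mult_ldiv [simp]: "x \<cdot> (x \<rightharpoondown> y) = y"
proof -
  obtain z where "y = x \<cdot> z"
    using bij_mult[of x] by (auto simp: bij_def surj_def)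
  then show ?thesis by simp
qed

lemma ldiv_eq_iff: "x \<rightharpoondown> y = z \<longleftrightarrow> y = x \<cdot> z"
  by (metis ldiv_mult mult_ldiv)

lemma inv_mult: "inv (mult x) y = x \<rightharpoondown> y"
  using bij_mult[of x] by (simp add: bij_is_inj inv_f_eq)

lemma mult_inverse [simp]: "x \<cdot> x\<acute> = e" "x\<acute> \<cdot> x = e"
  by (simp_all add: linv_def mult_commute[of "x \<rightharpoondown> e"])

lemma inverse_unique: "x \<cdot> y = e \<Longrightarrow> x\<acute> = y"
  by (simp add: linv_def ldiv_eq_iff)

lemma inverse_inverse [simp]: "(x\<acute>)\<acute> = x"
  by (simp add: inverse_unique)

lemma inner_in_inn: "inner x y \<in> inn mult e"
proof -
  have "inv (mult (x \<cdot> y)) \<circ> (mult x \<circ> (mult y \<circ> id)) \<in> mlt_group mult"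
    by (intro mlt_group.intros)
  moreover have "inv (mult (x \<cdot> y)) \<circ> (mult x \<circ> (mult y \<circ> id)) = inner x y"
    by (auto simp: inner_def inv_mult)
  ultimately show ?thesis
    by (simp add: inn_def inner_def ldiv_eq_iff)
qed

lemma inner_mult: "inner x y (u \<cdot> v) = inner x y u \<cdot> inner x y v"
  using inn_automorphism[OF inner_in_inn] by (simp add: automorphism_def)

lemma inner_e [simp]: "inner x y e = e"
  by (simp add: inner_def ldiv_eq_iff)

lemma inner_ldiv: "inner x y (u \<rightharpoondown> v) = inner x y u \<rightharpoondown> inner x y v"
  by (metis inner_mult ldiv_mult mult_ldiv)

lemma inner_inverse: "inner x y (u\<acute>) = (inner x y u)\<acute>"
  by (simp add: linv_def inner_ldiv)

lemma mult_inner: "(x \<cdot> y) \<cdot> inner x y w = x \<cdot> (y \<cdot> w)"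
  by (simp add: inner_def)

lemma inner_fixes [simp]: "inner x y x = x"
  by (simp add: inner_def ldiv_eq_iff mult_commute[of x y] mult_commute[of x "y \<cdot> x"])

text \<open>Since \<open>x\<acute> \<cdot> x = e\<close>, the automorphism
  \<open>inner (x\<acute>) x\<close> is just the two translations composed. It fixes
  \<open>x\<acute>\<close>, hence \<open>x\<close>, and so commutes with translation by
  \<open>x\<close>.\<close>

lemma inverse_mult_left_commute: "x \<cdot> (x\<acute> \<cdot> w) = x\<acute> \<cdot> (x \<cdot> w)"
proof -
  have fixes_x: "inner (x\<acute>) x x = x"
    by (metis inner_fixes inner_inverse inverse_inverse)
  have eq: "inner (x\<acute>) x u = x\<acute> \<cdot> (x \<cdot> u)" for u
    using mult_inner[of "x\<acute>" x u] by simp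
  from inner_mult[of "x\<acute>" x x "x \<rightharpoondown> w"] show ?thesis
    by (simp add: fixes_x) (simp add: eq)
qed

lemma square_mult_left_commute: "x \<cdot> ((x \<cdot> x) \<cdot> w) = (x \<cdot> x) \<cdot> (x \<cdot> w)"
proof -
  define u where "u = x \<rightharpoondown> (x \<rightharpoondown> (x \<cdot> x) \<cdot> w)"
  have "inner x x u = w"
    by (simp add: inner_def u_def)
  moreover have "inner x x (x \<cdot> u) = x \<cdot> inner x x u"
    by (simp add: inner_mult)
  ultimately show ?thesis
    using mult_inner[of x x "x \<cdot> u"] by (simp add: u_def)
qed

lemma inner_inverse_right: "inner x y (y\<acute>) = x \<cdot> y \<rightharpoondown> x"
  by (simp add: inner_def)

lemma inner_right: "inner x y y = (x \<cdot> y \<rightharpoondown> x)\<acute>"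
  by (metis inner_inverse inner_inverse_right inverse_inverse)

text \<open>With \<open>x = z u\<close> and \<open>z = x y\<close>, apply \<open>inner x y\<close>, which fixes \<open>x\<close>, to \<open>(y \<rightharpoondown> x\<acute>) \<cdot> y = x\<acute>\<close>.\<close>

lemma inverse_mult: "(z \<cdot> u)\<acute> = z\<acute> \<cdot> u\<acute>"
proof -
  define x where "x = z \<cdot> u"
  define y where "y = x \<rightharpoondown> z"
  have z: "x \<cdot> y = z"
    by (simp add: y_def)
  have "inner x y (y \<rightharpoondown> x\<acute>) = z\<acute>"
    by (simp add: inner_def z) (simp add: linv_def)
  moreover have "inner x y y = u\<acute>"
    by (simp add: inner_right z) (simp add: x_def)
  moreover have "inner x y ((y \<rightharpoondown> x\<acute>) \<cdot> y) = x\<acute>"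
    by (simp add: mult_commute[of _ y] inner_inverse)
  ultimately show ?thesis
    by (simp add: inner_mult x_def)
qed

lemma inverse_ldiv: "(x \<rightharpoondown> y)\<acute> = x\<acute> \<rightharpoondown> y\<acute>"
  by (metis inverse_mult ldiv_mult mult_ldiv)

text \<open>By \<open>inverse_mult\<close>, inverting both parameters conjugates the map by
  inversion, with which an automorphism commutes.\<close>

lemma inner_inverse_inverse: "inner (x\<acute>) (y\<acute>) w = inner x y w"
proof -
  have "inner (x\<acute>) (y\<acute>) w = (inner x y (w\<acute>))\<acute>"
    by (simp add: inner_def inverse_mult inverse_ldiv)
  then show ?thesis
    by (simp add: inner_inverse)
qed

lemma P_inverse_mult: "P x (x\<acute> \<cdot> w) = x \<cdot> w"
  by (simp add: P_def inverse_mult_left_commute)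

lemma P_e: "P x e = x \<cdot> x"
  using P_inverse_mult[of x x] by simp

lemma P_mult_left: "P x (x \<cdot> w) = x \<cdot> P x w"
proof -
  have "P x (x \<cdot> (x\<acute> \<cdot> u)) = x \<cdot> P x (x\<acute> \<cdot> u)" for u
    by (simp add: inverse_mult_left_commute P_inverse_mult)
  from this[of "x\<acute> \<rightharpoondown> w"] show ?thesis by simp
qed

text \<open>Dividing \<open>x \<cdot> (y \<cdot> u)\<close> by \<open>x \<cdot> y\<close>, and
  \<open>x\<acute> \<cdot> (y\<acute> \<cdot> u)\<close> by its inverse, leaves the same element
  \<open>inner x y u\<close>.\<close>

lemma P_mult: "P (x \<cdot> y) (x\<acute> \<cdot> w) = x \<cdot> P y w"
proof -
  define u where "u = y\<acute> \<rightharpoondown> w"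
  have w: "w = y\<acute> \<cdot> u"
    by (simp add: u_def)
  have "x\<acute> \<cdot> w = (x \<cdot> y)\<acute> \<cdot> inner x y u"
    by (metis w inner_inverse_inverse inverse_mult mult_inner)
  then have "P (x \<cdot> y) (x\<acute> \<cdot> w) = x \<cdot> (y \<cdot> u)"
    by (simp add: P_inverse_mult mult_inner)
  then show ?thesis
    by (simp add: w P_inverse_mult)
qed

lemma P_mult_inverse: "P (x \<cdot> y) (x\<acute>) = x \<cdot> (y \<cdot> y)"
  using P_mult[of x y e] by (simp add: P_e)

text \<open>On multiples of \<open>x\<acute>\<close>, \<open>P x\<close> turns that factor into
  \<open>x\<close>; both sides then reduce to \<open>x \<cdot> P u v\<close>.\<close>

lemma P_P: "P (P x y) w = P x (P y (P x w))"
proof -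
  define u where "u = x\<acute> \<rightharpoondown> y"
  define v where "v = x\<acute> \<rightharpoondown> w"
  have y: "y = x\<acute> \<cdot> u" and w: "w = x\<acute> \<cdot> v"
    by (simp_all add: u_def v_def)
  have "P (x\<acute> \<cdot> u) (x \<cdot> v) = x\<acute> \<cdot> P u v"
    using P_mult[of "x\<acute>" u v] by simp
  then show ?thesis
    by (simp add: y w P_inverse_mult P_mult)
qed

lemma inner_P: "inner x y (P u w) = P (inner x y u) (inner x y w)"
  by (simp add: P_def inner_ldiv inner_mult inner_inverse)

lemma inner_P_left: "inner x y (P y x) = x \<cdot> (y \<cdot> y)"
proof -
  define z u where "z = x \<cdot> y" and "u = z \<rightharpoondown> x"
  have a: "inner x y y = u\<acute>"
    by (simp add: inner_right u_def z_def)
  have x: "u \<cdot> z = x"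
    by (simp add: u_def mult_commute[of _ z])
  \<comment> \<open>The image to compute is
    \<open>P (u\<acute>) x = u \<rightharpoondown> u\<acute> \<cdot> x\<close>, so multiply the
    claim by \<open>u\<close>.\<close>
  have "u \<cdot> (x \<cdot> (y \<cdot> y)) = u \<cdot> (u\<acute> \<cdot> z)"
    using mult_inner[of x y y] by (simp add: a z_def mult_commute[of "u\<acute>"])
  also have "\<dots> = u\<acute> \<cdot> x"
    by (simp add: inverse_mult_left_commute x)
  finally show ?thesis
    by (simp add: inner_P a) (simp add: P_def ldiv_eq_iff)
qed

text \<open>Translation by \<open>inner x y y\<close> is translation by \<open>y\<close> conjugated
  by the automorphism \<open>inner x y\<close>.\<close>

lemma mult_inner_right_mult:
  "(x \<cdot> y) \<cdot> (inner x y y \<cdot> v) = x \<cdot> (y \<cdot> (x \<rightharpoondown> (x \<cdot> y) \<cdot> v))"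
proof -
  define u where "u = y \<rightharpoondown> (x \<rightharpoondown> (x \<cdot> y) \<cdot> v)"
  have "v = inner x y u"
    by (simp add: inner_def u_def)
  then have "(x \<cdot> y) \<cdot> (inner x y y \<cdot> v) = x \<cdot> (y \<cdot> (y \<cdot> u))"
    by (simp add: inner_mult[symmetric] mult_inner)
  then show ?thesis
    by (simp add: u_def)
qed

text \<open>The same conjugation for \<open>P y\<close>, which commutes with translation by
  \<open>y\<close>, so only \<open>x\<close> and \<open>x \<cdot> y\<close> remain.\<close>

lemma mult_P_inner_right:
  "(x \<cdot> y) \<cdot> P (inner x y y) v = P (x \<cdot> y) (P (x\<acute>) ((x \<cdot> y) \<cdot> v))"
proof -
  define q where "q = x \<rightharpoondown> (x \<cdot> y) \<cdot> v"
  have q: "(x \<cdot> y) \<cdot> v = x \<cdot> q"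
    by (simp add: q_def)
  have v: "v = inner x y (y \<rightharpoondown> q)"
    by (simp add: inner_def q_def)
  have "(x \<cdot> y) \<cdot> P (inner x y y) v = x \<cdot> (y \<cdot> P y (y \<rightharpoondown> q))"
    by (subst v) (simp add: inner_P[symmetric] mult_inner)
  also have "\<dots> = x \<cdot> P y q"
    by (simp add: P_mult_left[symmetric])
  also have "\<dots> = P (x \<cdot> y) (P (x\<acute>) (x \<cdot> q))"
    using P_inverse_mult[of "x\<acute>" q] by (simp add: P_mult)
  finally show ?thesis
    by (simp add: q)
qed

theorem square_mult_square:
  "(x \<cdot> x) \<cdot> (y \<cdot> y) = loop_oplus mult e x y \<cdot> loop_oplus mult e x y"
proof -
  define z a b w where "z = x \<cdot> y" and "a = inner x y y" and "b = inner y x x" and "w = a \<cdot> b"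
  have z': "y \<cdot> x = z"
    by (simp add: z_def mult_commute)
  have w: "loop_oplus mult e x y = w"
    by (simp add: loop_oplus_def inverse_mult w_def a_def b_def inner_right)
  \<comment> \<open>\<open>inner x y\<close> fixes \<open>x\<close> and sends the second factor to
    \<open>y \<cdot> y\<close>.\<close>
  define s where "s = (x \<cdot> x) \<cdot> (x \<rightharpoondown> P y x)"
  have "z \<cdot> a = P z (x\<acute>)"
    by (simp add: z_def a_def mult_inner P_mult_inverse)
  then have "z \<cdot> P b a = P z (P (y\<acute>) (P z (x\<acute>)))"
    using mult_P_inner_right[of y x a] by (simp add: b_def z')
  \<comment> \<open>By \<open>P_P\<close> the triple product is \<open>P\<close> at
    \<open>P z (y\<acute>) = y \<cdot> (x \<cdot> x)\<close>.\<close>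
  also have "\<dots> = P (y \<cdot> (x \<cdot> x)) (x\<acute>)"
    by (simp add: P_P[symmetric] P_mult_inverse flip: z')
  \<comment> \<open>This form of the argument lets \<open>P_mult\<close> split off
    \<open>x \<cdot> x\<close>.\<close>
  also have "x\<acute> = (x \<cdot> x)\<acute> \<cdot> x"
    using inverse_mult_left_commute[of x "x\<acute>"]
    by (simp add: inverse_mult mult_commute[of "x\<acute> \<cdot> x\<acute>" x])
  also have "P (y \<cdot> (x \<cdot> x)) \<dots> = (x \<cdot> x) \<cdot> P y x"
    by (simp add: mult_commute[of y "x \<cdot> x"] P_mult)
  also have "\<dots> = x \<cdot> s"
    by (simp add: s_def square_mult_left_commute)
  finally have zPba: "z \<cdot> P b a = x \<cdot> s" .
  \<comment> \<open>Here \<open>w \<cdot> w = P w e\<close> with \<open>e\<close> read as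
    \<open>a\<acute> \<cdot> a\<close>.\<close>
  have "w \<cdot> w = a \<cdot> P b a"
    using P_mult[of a b a] by (simp add: w_def P_e)
  then have "z \<cdot> (w \<cdot> w) = x \<cdot> (y \<cdot> s)"
    using mult_inner_right_mult[of x y "P b a"] zPba by (simp add: a_def z_def)
  also have "\<dots> = z \<cdot> inner x y s"
    by (simp add: z_def mult_inner)
  also have "inner x y s = (x \<cdot> x) \<cdot> (y \<cdot> y)"
    by (simp add: s_def inner_mult inner_ldiv inner_P_left)
  finally show ?thesis
    by (simp add: w)
qed

end

theorem theorem4p1:
  fixes m :: "'a \<Rightarrow> 'a \<Rightarrow> 'a" and e x y :: 'a
  assumes "comm_A_loop m e"
  shows "m (m x x) (m y y) = m (loop_oplus m e x y) (loop_oplus m e x y)"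
  using assms by (intro comm_automorphic_loop.square_mult_square comm_automorphic_loop.intro)

end
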